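(* Let $F:\mathbb{R}^d\to\mathbb{R}$ be a twice Fréchet differentiable functional, and let $L,T:\mathbb{R}^d\to\mathbb{R}^d$ be two linear operators that are self-adjoint and positive semi-definite with respect to $\langle\cdot,\cdot\rangle_w$, with $\ker L=\ker T=\operatorname{span}\{\boldsymbol{1}\}$. If $\boldsymbol{u}^*\in\mathbb{R}^d$ is an index-$k$ saddle point of $F$ with respect to the inner product $\langle\cdot,\cdot\rangle_L$, then $\boldsymbol{u}^*$ is also an index-$k$ saddle point of $F$ with respect to the inner product $\langle\cdot,\cdot\rangle_T$.
   Context: Fix weights $\boldsymbol{w}=(w_1,\dots,w_d)^\top$ with $w_i>0$, $\sum_{i=1}^d w_i=1$, and the inner product $\langle\boldsymbol{u},\boldsymbol{v}\rangle_w=\sum_{i=1}^d w_iu_iv_i$ on $\mathbb{R}^d$. Let $\boldsymbol{1}=(1,\dots,1)^\top$ and $\mathbb{R}^d_0=\{\boldsymbol{u}\in\mathbb{R}^d:\langle\boldsymbol{1},\boldsymbol{u}\rangle_w=0\}$. $\nabla F(\boldsymbol{u})$ and $\nabla^2F(\boldsymbol{u})$ are the gradient and Hessian of $F$ with respect to $\langle\cdot,\cdot\rangle_w$. For a linear operator $A:\mathbb{R}^d\to\mathbb{R}^d$ that is self-adjoint and positive semi-definite with respect to $\langle\cdot,\cdot\rangle_w$ and has $\ker A=\operatorname{span}\{\boldsymbol{1}\}$, the restriction $A_0:\mathbb{R}^d_0\to\mathbb{R}^d_0$ is invertible, self-adjoint and positive definite; on $\mathbb{R}^d_0$ define $\langle\boldsymbol{u},\boldsymbol{v}\rangle_A=\langle\boldsymbol{u},A_0^{-1}\boldsymbol{v}\rangle_w$.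 Put $\nabla_AF(\boldsymbol{u})=A\nabla F(\boldsymbol{u})$ and $\nabla^2_AF(\boldsymbol{u})=A\nabla^2F(\boldsymbol{u})$, the latter regarded as an operator $\mathbb{R}^d_0\to\mathbb{R}^d_0$ (these are the gradient and Hessian of $F$ along $\boldsymbol{u}+\mathbb{R}^d_0$ with respect to $\langle\cdot,\cdot\rangle_A$). A point $\boldsymbol{u}$ is an index-$k$ saddle point of $F$ with respect to $\langle\cdot,\cdot\rangle_A$ if $\nabla_AF(\boldsymbol{u})=0$ and $\nabla^2_AF(\boldsymbol{u}):\mathbb{R}^d_0\to\mathbb{R}^d_0$ is invertible with exactly $k$ negative eigenvalues (counted with multiplicity). *)

theory Defs
  imports "HOL-Analysis.Analysis"
begin

definition winner :: "real^'n \<Rightarrow> real^'n \<Rightarrow> real^'n \<Rightarrow> real" where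
  "winner w u v = (\<Sum>i\<in>UNIV. w $ i * u $ i * v $ i)"

definition mean_zero :: "real^'n \<Rightarrow> (real^'n) set" where
  "mean_zero w = {u. winner w 1 u = 0}"

definition self_adjoint_w :: "real^'n \<Rightarrow> (real^'n \<Rightarrow> real^'n) \<Rightarrow> bool" where
  "self_adjoint_w w A \<longleftrightarrow> (\<forall>u v. winner w (A u) v = winner w u (A v))"

definition pos_semidef_w :: "real^'n \<Rightarrow> (real^'n \<Rightarrow> real^'n) \<Rightarrow> bool" where
  "pos_semidef_w w A \<longleftrightarrow> (\<forall>u. winner w (A u) u \<ge> 0)"

definition inner_op :: "real^'n \<Rightarrow> (real^'n \<Rightarrow> real^'n) \<Rightarrow> real^'n \<Rightarrow> real^'n \<Rightarrow> real" where
  "inner_op w A u v = winner w u (inv_into (mean_zero w) A v)"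


definition frechet :: "('a::real_normed_vector \<Rightarrow> 'b::real_normed_vector) \<Rightarrow> 'a \<Rightarrow> 'a \<Rightarrow>\<^sub>L 'b" where
  "frechet F u = Blinfun (frechet_derivative F (at u))"

definition twice_frechet_differentiable ::
  "('a::real_normed_vector \<Rightarrow> 'b::real_normed_vector) \<Rightarrow> bool" where
  "twice_frechet_differentiable F \<longleftrightarrow>
     (\<forall>u. F differentiable (at u)) \<and> (\<forall>u. frechet F differentiable (at u))"

definition riesz :: "real^'n \<Rightarrow> (real^'n \<Rightarrow> real) \<Rightarrow> real^'n" where
  "riesz w \<phi> = (THE g. \<forall>v. \<phi> v = winner w g v)"

text \<open>The gradient represents the first derivative \<open>DF(u)[v] = \<langle>\<nabla>F(u), v\<rangle>\<close> and the
  Hessian the second derivative \<open>D\<^sup>2F(u)[v][z] = \<langle>\<nabla>\<^sup>2F(u) v, z\<rangle>\<close> in the weighted inner product.\<close>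

definition grad_w :: "real^'n \<Rightarrow> (real^'n \<Rightarrow> real) \<Rightarrow> real^'n \<Rightarrow> real^'n" where
  "grad_w w F u = riesz w (blinfun_apply (frechet F u))"

definition hess_w :: "real^'n \<Rightarrow> (real^'n \<Rightarrow> real) \<Rightarrow> real^'n \<Rightarrow> real^'n \<Rightarrow> real^'n" where
  "hess_w w F u v = riesz w (blinfun_apply (blinfun_apply (frechet (frechet F) u) v))"

definition grad_op ::
  "real^'n \<Rightarrow> (real^'n \<Rightarrow> real^'n) \<Rightarrow> (real^'n \<Rightarrow> real) \<Rightarrow> real^'n \<Rightarrow> real^'n" where
  "grad_op w A F u = A (grad_w w F u)"

definition hess_op ::
  "real^'n \<Rightarrow> (real^'n \<Rightarrow> real^'n) \<Rightarrow> (real^'n \<Rightarrow> real) \<Rightarrow> real^'n \<Rightarrow> real^'n \<Rightarrow> real^'n" where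
  "hess_op w A F u v = A (hess_w w F u v)"


definition eigenvalue_on :: "'a::real_vector set \<Rightarrow> ('a \<Rightarrow> 'a) \<Rightarrow> real \<Rightarrow> bool" where
  "eigenvalue_on S B c \<longleftrightarrow> (\<exists>v\<in>S. v \<noteq> 0 \<and> B v = c *\<^sub>R v)"

text \<open>Algebraic multiplicity, as the dimension of the generalized eigenspace.\<close>

definition multiplicity_on :: "'a::euclidean_space set \<Rightarrow> ('a \<Rightarrow> 'a) \<Rightarrow> real \<Rightarrow> nat" where
  "multiplicity_on S B c = dim {v\<in>S. \<exists>m. ((\<lambda>x. B x - c *\<^sub>R x) ^^ m) v = 0}"

definition num_neg_eigenvalues_on :: "'a::euclidean_space set \<Rightarrow> ('a \<Rightarrow> 'a) \<Rightarrow> nat" where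
  "num_neg_eigenvalues_on S B =
     (\<Sum>c | c < 0 \<and> eigenvalue_on S B c. multiplicity_on S B c)"

text \<open>The inner product \<^const>\<open>inner_op\<close> enters through its gradient \<^const>\<open>grad_op\<close> and Hessian
  \<^const>\<open>hess_op\<close>; see the lemmas \<open>inner_op_grad_op\<close> and \<open>inner_op_hess_op\<close> below.\<close>

definition index_saddle ::
  "real^'n \<Rightarrow> (real^'n \<Rightarrow> real^'n) \<Rightarrow> (real^'n \<Rightarrow> real) \<Rightarrow> nat \<Rightarrow> real^'n \<Rightarrow> bool" where
  "index_saddle w A F k u \<longleftrightarrow>
     grad_op w A F u = 0 \<and>
     bij_betw (hess_op w A F u) (mean_zero w) (mean_zero w) \<and>
     num_neg_eigenvalues_on (mean_zero w) (hess_op w A F u) = k"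


lemma frechet_works:
  assumes "F differentiable (at u)"
  shows "(F has_derivative frechet F u) (at u)"
proof -
  have "(F has_derivative frechet_derivative F (at u)) (at u)"
    using assms frechet_derivative_works by blast
  then show ?thesis
    unfolding frechet_def
    by (simp add: bounded_linear_Blinfun_apply has_derivative_bounded_linear)
qed

lemma linear_winner: "linear (winner w u)"
  by (rule linearI) (simp_all add: winner_def algebra_simps sum.distrib sum_distrib_left)

lemma winner_axis: "winner w u (axis i 1) = w $ i * u $ i"
proof -
  have "winner w u (axis i 1) = (\<Sum>j\<in>UNIV. if j = i then w $ i * u $ i else 0)"
    unfolding winner_def by (rule sum.cong) (auto simp: axis_def)
  then show ?thesis by simp
qed

lemma riesz_works:
  fixes w :: "real^'n"
  assumes w: "\<And>i. w $ i > 0" and lin: "linear \<phi>"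
  shows "winner w (riesz w \<phi>) v = \<phi> v"
proof -
  define g where "g = (\<chi> i. \<phi> (axis i 1) / w $ i)"
  have g: "\<phi> z = winner w g z" for z
  proof -
    have "\<phi> z = \<phi> (\<Sum>i\<in>UNIV. z $ i *\<^sub>R axis i 1)"
      by (simp add: basis_expansion flip: scalar_mult_eq_scaleR)
    also have "\<dots> = (\<Sum>i\<in>UNIV. z $ i * \<phi> (axis i 1))"
      by (simp add: linear_sum[OF lin] linear_cmul[OF lin])
    also have "\<dots> = winner w g z"
      unfolding winner_def g_def using less_imp_neq[OF w] by (intro sum.cong) auto
    finally show ?thesis .
  qed
  have "\<forall>v. \<phi> v = winner w (riesz w \<phi>) v"
    unfolding riesz_def
  proof (rule theI[where a = g])
    show "\<forall>v. \<phi> v = winner w g v" using g by blast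
  next
    fix h assume "\<forall>v. \<phi> v = winner w h v"
    then have "w $ i * h $ i = w $ i * g $ i" for i
      using g by (metis winner_axis)
    then show "h = g"
      using w by (metis less_irrefl mult_cancel_left vec_eq_iff)
  qed
  then show ?thesis by simp
qed

lemma inner_op_apply:
  fixes w :: "real^'n"
  assumes w: "\<And>i. w $ i > 0" and A: "linear A" "self_adjoint_w w A" "{u. A u = 0} = span {1}"
    and v: "v \<in> mean_zero w"
  shows "inner_op w A (A g) v = winner w g v"
proof -
  let ?S = "mean_zero w"
  have S: "subspace ?S"
    unfolding mean_zero_def by (rule linear_subspace_kernel[OF linear_winner])
  have A1: "A 1 = 0"
    using A(3) span_base[of 1 "{1::real^'n}"] by auto
  have maps: "A ` ?S \<subseteq> ?S"
  proof (intro subsetI, elim imageE)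
    fix x y assume "x = A y"
    then have "winner w 1 x = winner w (A 1) y"
      using A(2) by (simp add: self_adjoint_w_def)
    then show "x \<in> ?S"
      by (simp add: A1 mean_zero_def) (simp add: winner_def)
  qed
  have "u = 0" if "u \<in> ?S" "A u = 0" for u
  proof -
    from that A(3) obtain c where c: "u = c *\<^sub>R 1"
      by (auto simp: span_singleton)
    then have "c * sum (($) w) UNIV = 0"
      using that(1) by (simp add: mean_zero_def winner_def sum_distrib_left mult_ac)
    moreover have "sum (($) w) UNIV > 0"
      using w by (intro sum_pos) auto
    ultimately show "u = 0" using c by simp
  qed
  then have inj: "inj_on A ?S"
    using linear_inj_on_iff_eq_0[OF A(1) S] by blast
  have "A ` ?S = ?S"
  proof (rule subspace_dim_equal)
    show "subspace (A ` ?S)" by (rule linear_subspace_image[OF A(1) S])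
    show "subspace ?S" by (rule S)
    show "A ` ?S \<subseteq> ?S" by (rule maps)
    show "dim ?S \<le> dim (A ` ?S)"
      using dim_image_eq[OF A(1), of ?S] inj span_eq_iff S by (metis order_refl)
  qed
  then have "A (inv_into ?S A v) = v"
    using v by (intro f_inv_into_f) simp
  then show ?thesis
    using A(2) unfolding inner_op_def self_adjoint_w_def by metis
qed

lemma inner_op_grad_op:
  fixes w :: "real^'n"
  assumes "\<And>i. w $ i > 0" "linear A" "self_adjoint_w w A" "{u. A u = 0} = span {1}"
    and "v \<in> mean_zero w"
  shows "inner_op w A (grad_op w A F u) v = frechet F u v"
  unfolding grad_op_def inner_op_apply[OF assms] grad_w_def
  by (rule riesz_works) (auto simp: assms bounded_linear.linear[OF blinfun.bounded_linear_right])

lemma inner_op_hess_op: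
  fixes w :: "real^'n"
  assumes "\<And>i. w $ i > 0" "linear A" "self_adjoint_w w A" "{u. A u = 0} = span {1}"
    and "z \<in> mean_zero w"
  shows "inner_op w A (hess_op w A F u v) z = frechet (frechet F) u v z"
  unfolding hess_op_def inner_op_apply[OF assms] hess_w_def
  by (rule riesz_works) (auto simp: assms bounded_linear.linear[OF blinfun.bounded_linear_right])

end

theory Submission
  imports Defs
begin

text \<open>The operator \<open>A \<nabla>\<^sup>2F(u)\<close> is self-adjoint on \<^term>\<open>mean_zero w\<close> with respect to
  \<^term>\<open>inner_op w A\<close>, since \<open>D\<^sup>2F(u)\<close> is symmetric, and its quadratic form
  \<open>\<langle>x, A \<nabla>\<^sup>2F(u) x\<rangle>\<^sub>A = \<langle>x, \<nabla>\<^sup>2F(u) x\<rangle>\<^sub>w\<close> does not depend on \<open>A\<close>. By the spectral theorem it has an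
  orthogonal eigenbasis, and Sylvester's law of inertia shows that the number of negative eigenvalues
  is determined by the quadratic form alone. Criticality and invertibility depend on \<open>A\<close> only
  through its kernel.\<close>

section \<open>Symmetry of the second derivative\<close>

text \<open>The mixed second difference of \<open>F\<close> with steps \<open>t h\<close> and
  \<open>t k\<close> is unchanged when \<open>h\<close> and \<open>k\<close> are swapped, and it
  equals t^2 times \<open>D2 k h\<close> up to o(t^2). Differentiability of \<open>D\<close> at the
  single point \<open>u\<close> suffices for this estimate.\<close>

lemma second_derivative_symmetric:
  fixes F :: "'a::real_normed_vector \<Rightarrow> real" and D :: "'a \<Rightarrow> 'a \<Rightarrow>\<^sub>L real"
  assumes F: "\<And>x. (F has_derivative D x) (at x)"
    and D: "(D has_derivative D2) (at u)"
  shows "D2 h k = D2 k h"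
proof -
  interpret D2: bounded_linear D2
    using D by (rule has_derivative_bounded_linear)
  let ?\<Delta> = "\<lambda>t h k. F (u + t *\<^sub>R h + t *\<^sub>R k) - F (u + t *\<^sub>R h) - F (u + t *\<^sub>R k) + F u"
  have est: "\<bar>?\<Delta> t h k - t\<^sup>2 * D2 k h\<bar> \<le> 2 * e * t\<^sup>2 * (norm h + norm k) * norm h"
    if e: "e > 0" and t: "t > 0" "t * (norm h + norm k) < d"
      and d: "\<And>y. norm (y - u) < d \<Longrightarrow> norm (D y - D u - D2 (y - u)) \<le> e * norm (y - u)"
    for e t d :: real and h k
  proof -
    \<comment> \<open>The second difference is the increment over [0, t] of this function of
      \<open>s\<close>, so the mean value theorem reduces it to a difference of first
      derivatives.\<close>
    have G: "((\<lambda>s. F (u + s *\<^sub>R h + t *\<^sub>R k) - F (u + s *\<^sub>R h)) has_real_derivative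
        (D (u + s *\<^sub>R h + t *\<^sub>R k) h - D (u + s *\<^sub>R h) h)) (at s)" for s
    proof -
      have "((\<lambda>s. F (u + s *\<^sub>R h + t *\<^sub>R k) - F (u + s *\<^sub>R h)) has_derivative
          (\<lambda>x. D (u + s *\<^sub>R h + t *\<^sub>R k) (x *\<^sub>R h) - D (u + s *\<^sub>R h) (x *\<^sub>R h))) (at s)"
        by (rule has_derivative_diff; rule has_derivative_compose[OF _ F])
           (auto intro!: derivative_eq_intros)
      then show ?thesis
        unfolding has_field_derivative_def
        by (rule has_derivative_eq_rhs) (auto simp: blinfun.scaleR_right algebra_simps)
    qed
    obtain s where s: "0 < s" "s < t" and
      \<Delta>: "?\<Delta> t h k = t * (D (u + s *\<^sub>R h + t *\<^sub>R k) h - D (u + s *\<^sub>R h) h)"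
      using MVT2[OF t(1), of _ "\<lambda>s. D (u + s *\<^sub>R h + t *\<^sub>R k) h - D (u + s *\<^sub>R h) h", OF G]
      by (force simp: algebra_simps)
    define R where "R y = D y - D u - D2 (y - u)" for y
    have R: "norm (R (u + y)) \<le> e * (t * (norm h + norm k))"
      if "norm y \<le> t * (norm h + norm k)" for y
    proof -
      have "norm (R (u + y)) \<le> e * norm y"
        using d[of "u + y"] that t(2) by (simp add: R_def)
      also have "\<dots> \<le> e * (t * (norm h + norm k))"
        using that e by (intro mult_left_mono) auto
      finally show ?thesis .
    qed
    have sh: "norm (s *\<^sub>R h) \<le> t * norm h"
      using s by (simp add: mult_right_mono)
    then have 1: "norm (s *\<^sub>R h) \<le> t * (norm h + norm k)"
      using t(1) by (simp add: distrib_left add_increasing2)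
    have 2: "norm (s *\<^sub>R h + t *\<^sub>R k) \<le> t * (norm h + norm k)"
      using norm_triangle_ineq[of "s *\<^sub>R h" "t *\<^sub>R k"] sh t(1) by (simp add: distrib_left)
    define R1 where "R1 = R (u + (s *\<^sub>R h + t *\<^sub>R k))"
    define R0 where "R0 = R (u + s *\<^sub>R h)"
    \<comment> \<open>Both values of \<open>D\<close> are expanded at \<open>u\<close>. The
      contributions of \<open>D2 (s h)\<close> cancel, so the unknown \<open>s\<close> survives only
      in the remainders.\<close>
    have Reqn: "D (u + s *\<^sub>R h + t *\<^sub>R k) - D (u + s *\<^sub>R h) = t *\<^sub>R D2 k + (R1 - R0)"
      by (simp add: R1_def R0_def R_def D2.add D2.scaleR add.assoc)
    have "D (u + s *\<^sub>R h + t *\<^sub>R k) h - D (u + s *\<^sub>R h) h = t * D2 k h + (R1 - R0) h"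
      unfolding blinfun.diff_left[symmetric] Reqn by (simp add: blinfun.add_left blinfun.scaleR_left)
    then have "?\<Delta> t h k - t\<^sup>2 * D2 k h = t * (R1 - R0) h"
      unfolding \<Delta> by (simp add: distrib_left power2_eq_square)
    also have "\<bar>\<dots>\<bar> \<le> t * (norm (R1 - R0) * norm h)"
      using norm_blinfun[of "R1 - R0" h] t(1) by (simp add: abs_mult)
    also have "\<dots> \<le> t * (2 * (e * (t * (norm h + norm k))) * norm h)"
    proof (intro mult_left_mono mult_right_mono)
      show "norm (R1 - R0) \<le> 2 * (e * (t * (norm h + norm k)))"
        using norm_triangle_ineq4[of R1 R0] R[OF 1] R[OF 2] unfolding R1_def R0_def by linarith
    qed (use t(1) in auto)
    also have "\<dots> = 2 * e * t\<^sup>2 * (norm h + norm k) * norm h"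
      by (simp only: power2_eq_square mult_ac)
    finally show ?thesis .
  qed
  have "\<bar>D2 h k - D2 k h\<bar> \<le> e" if "e > 0" for e :: real
  proof -
    define M where "M = norm h + norm k"
    have M: "M \<ge> 0" by (simp add: M_def)
    \<comment> \<open>Adding the two estimates produces the factor M^2. The summand 1 keeps the
      divisor in \<open>e'\<close> positive even if \<open>h\<close> and \<open>k\<close> both
      vanish.\<close>
    define N where "N = M\<^sup>2 + 1"
    have N: "N > 0" by (simp add: N_def add_nonneg_pos)
    define e' where "e' = e / (2 * N)"
    have e': "e' > 0"
      using that N by (simp add: e'_def)
    obtain d where d: "d > 0"
      "\<And>y. norm (y - u) < d \<Longrightarrow> norm (D y - D u - D2 (y - u)) \<le> e' * norm (y - u)"
      using D e' unfolding has_derivative_within_alt by auto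
    \<comment> \<open>Small enough that all points of the second difference stay within distance
      \<open>d\<close> of \<open>u\<close>; again \<open>M + 1\<close> avoids division by
      zero.\<close>
    define t where "t = d / (M + 1) / 2"
    have t: "t > 0" using d(1) M by (simp add: t_def)
    have "t * M \<le> t * (M + 1)" using t by simp
    also have "\<dots> = d / 2" using M by (simp add: t_def field_simps)
    finally have tM: "t * M < d" using d(1) by simp
    have "\<bar>?\<Delta> t h k - t\<^sup>2 * D2 k h\<bar> \<le> 2 * e' * t\<^sup>2 * M * norm h"
      "\<bar>?\<Delta> t k h - t\<^sup>2 * D2 h k\<bar> \<le> 2 * e' * t\<^sup>2 * M * norm k"
      using est[OF e' t _ d(2), of h k] est[OF e' t _ d(2), of k h] tM
      by (auto simp: M_def add.commute)
    moreover have "?\<Delta> t h k = ?\<Delta> t k h"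
      by (simp add: add_ac)
    ultimately have "\<bar>t\<^sup>2 * D2 h k - t\<^sup>2 * D2 k h\<bar> \<le> 2 * e' * t\<^sup>2 * M * norm h + 2 * e' * t\<^sup>2 * M * norm k"
      by linarith
    also have "\<dots> = t\<^sup>2 * (2 * e' * M\<^sup>2)"
      by (simp add: M_def power2_eq_square algebra_simps)
    finally have "t\<^sup>2 * \<bar>D2 h k - D2 k h\<bar> \<le> t\<^sup>2 * (2 * e' * M\<^sup>2)"
      by (simp add: abs_mult flip: right_diff_distrib)
    then have "\<bar>D2 h k - D2 k h\<bar> \<le> 2 * e' * M\<^sup>2"
      using t by (simp add: mult_le_cancel_left)
    also have "\<dots> \<le> 2 * e' * N" using e' by (simp add: N_def)
    also have "\<dots> = e" using N by (simp add: e'_def)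
    finally show ?thesis .
  qed
  then show ?thesis
    using field_le_epsilon[of "\<bar>D2 h k - D2 k h\<bar>" 0] by simp
qed

section \<open>Spectral theorem on an invariant subspace\<close>

text \<open>Bilinearity is required on the whole space so that the facts about
  \<open>bilinear\<close> apply directly, while symmetry and positivity concern only
  \<open>S\<close>. The next definition treats linearity of the operator in the same way.\<close>

definition inner_on :: "'a::euclidean_space set \<Rightarrow> ('a \<Rightarrow> 'a \<Rightarrow> real) \<Rightarrow> bool" where
  "inner_on S p \<longleftrightarrow> bilinear p \<and> (\<forall>x\<in>S. \<forall>y\<in>S. p x y = p y x) \<and> (\<forall>x\<in>S. x \<noteq> 0 \<longrightarrow> p x x > 0)"

definition self_adjoint_on ::
  "'a::euclidean_space set \<Rightarrow> ('a \<Rightarrow> 'a \<Rightarrow> real) \<Rightarrow> ('a \<Rightarrow> 'a) \<Rightarrow> bool" where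
  "self_adjoint_on S p B \<longleftrightarrow>
     linear B \<and> B ` S \<subseteq> S \<and> (\<forall>x\<in>S. \<forall>y\<in>S. p (B x) y = p x (B y))"

text \<open>A minimizer of the Rayleigh quotient \<open>Q\<close> is an eigenvector, and the minimum
  is its eigenvalue.\<close>

lemma eigenvector_exists:
  fixes p :: "'a::euclidean_space \<Rightarrow> 'a \<Rightarrow> real"
  assumes S: "subspace S" "S \<noteq> {0}" and "inner_on S p" and "self_adjoint_on S p B"
  obtains x c where "x \<in> S" "x \<noteq> 0" "B x = c *\<^sub>R x"
proof -
  have p: "bilinear p" and sym: "\<And>x y. x \<in> S \<Longrightarrow> y \<in> S \<Longrightarrow> p x y = p y x"
    and pos: "\<And>x. x \<in> S \<Longrightarrow> x \<noteq> 0 \<Longrightarrow> p x x > 0"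
    and B: "linear B" "B ` S \<subseteq> S"
    and sa: "\<And>x y. x \<in> S \<Longrightarrow> y \<in> S \<Longrightarrow> p (B x) y = p x (B y)"
    using assms(3,4) unfolding inner_on_def self_adjoint_on_def by blast+
  note bil = bilinear_ladd[OF p] bilinear_radd[OF p] bilinear_lmul[OF p] bilinear_rmul[OF p]
    bilinear_lsub[OF p] bilinear_rsub[OF p] bilinear_lzero[OF p] bilinear_rzero[OF p]
    linear_add[OF B(1)] linear_cmul[OF B(1)]
  interpret bounded_bilinear p
    using p by (simp add: bilinear_conv_bounded_bilinear)
  \<comment> \<open>The Euclidean unit sphere supplies compactness. It need not be the unit sphere
    of \<open>p\<close>, because \<open>Q\<close> is invariant under scaling.\<close>
  define K where "K = S \<inter> sphere 0 1"
  have K: "compact K"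
    unfolding K_def using closed_subspace[OF S(1)] by (simp add: closed_Int_compact)
  have KS: "x \<in> S \<and> x \<noteq> 0" if "x \<in> K" for x
    using that by (auto simp: K_def)
  have nK: "(1 / norm y) *\<^sub>R y \<in> K" if "y \<in> S" "y \<noteq> 0" for y
    using that S(1) by (simp add: K_def subspace_scale)
  obtain y where "y \<in> S" "y \<noteq> 0"
    using S subspace_0[OF S(1)] by blast
  then have "K \<noteq> {}"
    using nK by blast
  define Q where "Q x = p x (B x) / p x x" for x
  have "continuous_on K Q"
    unfolding Q_def using pos KS
    by (force intro!: continuous_intros continuous_on continuous_on_id
        linear_continuous_on[OF B(1)[unfolded linear_conv_bounded_linear]])
  then obtain x where x: "x \<in> K" "\<And>y. y \<in> K \<Longrightarrow> Q x \<le> Q y"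
    using continuous_attains_inf[OF K \<open>K \<noteq> {}\<close>] by blast
  \<comment> \<open>The form of \<open>B - Q x\<close>: minimality of \<open>Q x\<close> makes it
    nonnegative on \<open>S\<close>, and it vanishes at \<open>x\<close>.\<close>
  define r where "r y z = p y (B z) - Q x * p y z" for y z
  have r_nonneg: "r y y \<ge> 0" if "y \<in> S" for y
  proof (cases "y = 0")
    case False
    have "Q x \<le> Q ((1 / norm y) *\<^sub>R y)"
      using x(2) nK[OF that False] by blast
    also have "\<dots> = Q y"
      using False by (simp add: Q_def bil)
    finally show ?thesis
      using pos[OF that False] by (simp add: r_def Q_def[of y] field_simps)
  qed (simp add: r_def bil)
  have xS: "x \<in> S" "x \<noteq> 0" using KS x(1) by auto
  have rxx: "r x x = 0"
    using pos[OF xS] by (simp add: r_def Q_def)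
  define z where "z = B x - Q x *\<^sub>R x"
  have zS: "z \<in> S"
    using B(2) xS S(1) by (auto simp: z_def subspace_diff subspace_scale)
  have rzx: "r z x = p z z"
    by (simp add: r_def z_def bil algebra_simps)
  have rxz: "r x z = r z x"
    using sa[OF xS(1) zS] sym[OF xS(1) zS] sym[OF _ zS, of "B x"] xS(1) B(2) by (force simp: r_def)
  \<comment> \<open>Perturbing \<open>x\<close> along the residual \<open>z\<close> leaves a
    quadratic polynomial in \<open>t\<close> without constant term. Its nonnegativity forces the
    linear coefficient to vanish.\<close>
  have quad: "0 \<le> 2 * t * p z z + t\<^sup>2 * r z z" for t
  proof -
    have "r (x + t *\<^sub>R z) (x + t *\<^sub>R z) = r x x + t * r x z + t * r z x + t\<^sup>2 * r z z"
      by (simp add: r_def bil algebra_simps power2_eq_square)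
    then show ?thesis
      using r_nonneg[of "x + t *\<^sub>R z"] xS(1) zS S(1) rxx rxz rzx
      by (simp add: subspace_add subspace_scale)
  qed
  have "p z z \<le> 0"
  proof (rule ccontr)
    assume "\<not> p z z \<le> 0"
    then have pz: "p z z > 0" by simp
    \<comment> \<open>A negative \<open>t\<close> for which the linear term outweighs the quadratic
      one: the polynomial becomes \<open>t * (p z z - t)\<close>, which is negative.\<close>
    define t where "t = - p z z / (r z z + 1)"
    have rz: "r z z \<ge> 0" using r_nonneg zS by blast
    have t: "t < 0" using pz rz by (simp add: t_def divide_neg_pos)
    have "t * r z z = - p z z - t"
      using rz by (simp add: t_def field_simps)
    then have "t * (2 * p z z + t * r z z) = t * (p z z - t)"
      by simp
    then have "2 * t * p z z + t\<^sup>2 * r z z = t * (p z z - t)"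
      by (simp add: power2_eq_square algebra_simps)
    also have "\<dots> < 0"
      using t pz by (simp add: mult_neg_pos)
    finally show False using quad[of t] by simp
  qed
  then have "z = 0"
    using pos[OF zS] by force
  then show thesis
    using that[OF xS, of "Q x"] by (simp add: z_def)
qed

text \<open>Induction on the dimension: split off one eigenvector and continue in its
  \<open>p\<close>-orthogonal complement, which is invariant because \<open>B\<close> is
  self-adjoint.\<close>

theorem orthogonal_eigenbasis:
  fixes p :: "'a::euclidean_space \<Rightarrow> 'a \<Rightarrow> real"
  assumes "subspace S" and "inner_on S p" and "self_adjoint_on S p B"
  shows "\<exists>E. independent E \<and> span E = S \<and> pairwise (\<lambda>e f. p e f = 0) E \<and>
    (\<forall>e\<in>E. \<exists>c. B e = c *\<^sub>R e)"
  using assms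
proof (induction "dim S" arbitrary: S rule: less_induct)
  case less
  note S = less.prems(1)
  have p: "bilinear p" and sym: "\<And>x y. x \<in> S \<Longrightarrow> y \<in> S \<Longrightarrow> p x y = p y x"
    and pos: "\<And>x. x \<in> S \<Longrightarrow> x \<noteq> 0 \<Longrightarrow> p x x > 0"
    and B: "linear B" and inv: "B ` S \<subseteq> S"
    and sa: "\<And>x y. x \<in> S \<Longrightarrow> y \<in> S \<Longrightarrow> p (B x) y = p x (B y)"
    using less.prems(2,3) unfolding inner_on_def self_adjoint_on_def by blast+
  note bil = bilinear_ladd[OF p] bilinear_radd[OF p] bilinear_lmul[OF p] bilinear_rmul[OF p]
    bilinear_lsub[OF p] bilinear_rsub[OF p] bilinear_lzero[OF p] bilinear_rzero[OF p]
  show ?case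
  proof (cases "S = {0}")
    case True
    then show ?thesis
      by (intro exI[of _ "{}"]) (auto simp: independent_empty)
  next
    case False
    obtain x c where x: "x \<in> S" "x \<noteq> 0" "B x = c *\<^sub>R x"
      using eigenvector_exists[OF S False less.prems(2,3)] .
    have pxx: "p x x > 0" using pos x by blast
    define S' where "S' = {y\<in>S. p x y = 0}"
    have S': "subspace S'"
      using S by (auto simp: S'_def subspace_def bil)
    have "x \<notin> S'" using pxx by (auto simp: S'_def)
    then have "S' \<subset> S" using x(1) by (auto simp: S'_def)
    then have "dim S' < dim S"
      using S S' by (metis dim_psubset span_eq_iff)
    moreover have "B ` S' \<subseteq> S'"
    proof (intro subsetI, elim imageE)
      fix v y assume y: "v = B y" "y \<in> S'"
      then have "p x (B y) = p (B x) y" using sa x(1) by (auto simp: S'_def)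
      then show "v \<in> S'" using y inv by (auto simp: S'_def x(3) bil)
    qed
    ultimately obtain E where E: "independent E" "span E = S'" "pairwise (\<lambda>e f. p e f = 0) E"
      "\<forall>e\<in>E. \<exists>c. B e = c *\<^sub>R e"
      using less.hyps[of S'] p sym pos S' B sa by (auto simp: S'_def inner_on_def self_adjoint_on_def)
    have ES': "E \<subseteq> S'" using E(2) span_superset by blast
    show ?thesis
    proof (intro exI[of _ "insert x E"] conjI)
      show "independent (insert x E)"
        using E(1,2) \<open>x \<notin> S'\<close> by (simp add: independent_insertI)
      show "span (insert x E) = S"
      proof
        show "span (insert x E) \<subseteq> S"
          using x(1) ES' S by (intro span_minimal) (auto simp: S'_def)
        show "S \<subseteq> span (insert x E)"
        proof
          fix y assume y: "y \<in> S"
          \<comment> \<open>Subtracting the \<open>p\<close>-orthogonal projection onto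
            \<open>x\<close> lands in the complement, so \<open>x\<close> and \<open>E\<close>
            together span \<open>S\<close>.\<close>
          have "y - (p x y / p x x) *\<^sub>R x \<in> S'"
            using y x(1) S pxx by (simp add: S'_def bil subspace_diff subspace_scale)
          then show "y \<in> span (insert x E)"
            using E(2) unfolding span_insert by blast
        qed
      qed
      show "pairwise (\<lambda>e f. p e f = 0) (insert x E)"
        using E(3) ES' sym[OF x(1)] by (fastforce simp: pairwise_insert S'_def)
      show "\<forall>e\<in>insert x E. \<exists>c. B e = c *\<^sub>R e" using E(4) x(3) by blast
    qed
  qed
qed

section \<open>Counting negative eigenvalues and the law of inertia\<close>

text \<open>In an eigenbasis, powers of \<open>B - a\<close> merely scale the coordinates by powers
  of \<open>c e - a\<close>. Hence generalized eigenspaces are spanned by basis vectors, and each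
  algebraic multiplicity counts basis vectors.\<close>

lemma num_neg_eigenvalues_on_eigenbasis:
  fixes E :: "'a::euclidean_space set"
  assumes E: "independent E" and B: "linear B" and c: "\<And>e. e \<in> E \<Longrightarrow> B e = c e *\<^sub>R e"
  shows "num_neg_eigenvalues_on (span E) B = card {e\<in>E. c e < 0}"
proof -
  have fin: "finite E" using E by (rule independent_imp_finite)
  have gen: "{v \<in> span E. \<exists>m. ((\<lambda>x. B x - a *\<^sub>R x) ^^ m) v = 0} = span {e\<in>E. c e = a}"
    (is "?G = ?H") for a
  proof -
    have pow: "((\<lambda>x. B x - a *\<^sub>R x) ^^ m) (\<Sum>e\<in>E. f e *\<^sub>R e) = (\<Sum>e\<in>E. ((c e - a) ^ m * f e) *\<^sub>R e)"
      for m f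
    proof (induction m)
      case (Suc m)
      then show ?case
        by (simp add: linear_sum[OF B] linear_cmul[OF B] c scaleR_sum_right
            flip: sum_subtractf scaleR_diff_left) (simp add: algebra_simps)
    qed simp
    show ?thesis
    proof
      show "?G \<subseteq> ?H"
      proof
        fix v assume "v \<in> ?G"
        then obtain f m where v: "v = (\<Sum>e\<in>E. f e *\<^sub>R e)"
          and m: "((\<lambda>x. B x - a *\<^sub>R x) ^^ m) v = 0"
          by (auto simp: span_finite[OF fin])
        have "\<forall>r. (\<Sum>e\<in>E. r e *\<^sub>R e) = 0 \<longrightarrow> (\<forall>e\<in>E. r e = 0)"
          using E by (simp add: independent_explicit)
        from this[rule_format, of "\<lambda>e. (c e - a) ^ m * f e"]
        have "\<forall>e\<in>E. (c e - a) ^ m * f e = 0"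
          using m unfolding v pow by blast
        then have "c e = a \<or> f e = 0" if "e \<in> E" for e
          using that by auto
        then have "f e *\<^sub>R e \<in> ?H" if "e \<in> E" for e
          using that span_base[of e "{e\<in>E. c e = a}"]
          by (metis (mono_tags, lifting) mem_Collect_eq scale_zero_left span_scale span_zero)
        then show "v \<in> ?H" unfolding v by (intro span_sum)
      qed
      show "?H \<subseteq> ?G"
      proof
        fix v assume v: "v \<in> ?H"
        then have "B v - a *\<^sub>R v = 0"
          by (induction rule: span_induct)
            (auto simp: c subspace_def linear_0[OF B] linear_add[OF B] linear_cmul[OF B] algebra_simps)
        then have "((\<lambda>x. B x - a *\<^sub>R x) ^^ 1) v = 0" by simp
        then show "v \<in> ?G"
          using v span_mono[of "{e\<in>E. c e = a}" E] by blast
      qed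
    qed
  qed
  have mult: "multiplicity_on (span E) B a = card {e\<in>E. c e = a}" for a
    unfolding multiplicity_on_def gen dim_span
    by (rule dim_eq_card_independent) (rule independent_mono[OF E], auto)
  have eig: "eigenvalue_on (span E) B a \<longleftrightarrow> a \<in> c ` E" for a
  proof
    assume "eigenvalue_on (span E) B a"
    then obtain v where v: "v \<in> span E" "v \<noteq> 0" "B v = a *\<^sub>R v"
      by (auto simp: eigenvalue_on_def)
    then have "((\<lambda>x. B x - a *\<^sub>R x) ^^ 1) v = 0" by simp
    then have "v \<in> span {e\<in>E. c e = a}"
      using v(1) gen[of a] by blast
    then have "{e\<in>E. c e = a} \<noteq> {}" using v(2) by force
    then show "a \<in> c ` E" by blast
  next
    assume "a \<in> c ` E"
    then obtain e where "e \<in> E" "a = c e" by blast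
    moreover from this have "e \<noteq> 0" using E dependent_zero by blast
    ultimately show "eigenvalue_on (span E) B a"
      unfolding eigenvalue_on_def using c span_base by blast
  qed
  let ?N = "{e\<in>E. c e < 0}"
  have "num_neg_eigenvalues_on (span E) B = (\<Sum>a\<in>c ` ?N. card {e\<in>E. c e = a})"
    unfolding num_neg_eigenvalues_on_def eig mult by (rule sum.cong) auto
  also have "\<dots> = (\<Sum>a\<in>c ` ?N. \<Sum>e | e \<in> ?N \<and> c e = a. 1)"
    by (intro sum.cong) (auto intro!: arg_cong[where f = card])
  also have "\<dots> = card ?N"
    using fin by (subst sum.group) auto
  finally show ?thesis .
qed

text \<open>The negative eigenvectors of \<open>B\<close> span a subspace on which the common
  quadratic form is negative definite, the nonnegative ones of \<open>B'\<close> one on which it is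
  nonnegative, so these two subspaces meet only in \<open>0\<close>.\<close>

lemma num_neg_eigenvalues_on_le:
  fixes p p' :: "'a::euclidean_space \<Rightarrow> 'a \<Rightarrow> real"
  assumes S: "subspace S"
    and p: "inner_on S p" and B: "self_adjoint_on S p B"
    and p': "inner_on S p'" and B': "self_adjoint_on S p' B'"
    and q: "\<And>x. x \<in> S \<Longrightarrow> p x (B x) = p' x (B' x)"
  shows "num_neg_eigenvalues_on S B \<le> num_neg_eigenvalues_on S B'"
proof -
  \<comment> \<open>In an orthogonal family of eigenvectors all cross terms vanish and the quadratic
    form is diagonal.\<close>
  have expand: "r (\<Sum>e\<in>A. f e *\<^sub>R e) (C (\<Sum>e\<in>A. f e *\<^sub>R e)) = (\<Sum>e\<in>A. (f e)\<^sup>2 * c e * r e e)"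
    if "bilinear r" "linear C" "finite A" "pairwise (\<lambda>e f. r e f = 0) A"
      "\<And>e. e \<in> A \<Longrightarrow> C e = c e *\<^sub>R e"
    for r :: "'a \<Rightarrow> 'a \<Rightarrow> real" and C A f c
  proof -
    have "r (\<Sum>e\<in>A. f e *\<^sub>R e) (C (\<Sum>e\<in>A. f e *\<^sub>R e)) =
        (\<Sum>(e, e')\<in>A \<times> A. f e * (f e' * (c e' * r e e')))"
      using that(5) by (simp add: linear_sum[OF that(2)] linear_cmul[OF that(2)]
          bilinear_sum[OF that(1)] bilinear_lmul[OF that(1)] bilinear_rmul[OF that(1)]
          case_prod_unfold mem_Times_iff mult_ac cong: sum.cong)
    also have "\<dots> = (\<Sum>e\<in>A. \<Sum>e'\<in>A. f e * (f e' * (c e' * r e e')))"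
      by (simp add: sum.cartesian_product)
    also have "\<dots> = (\<Sum>e\<in>A. \<Sum>e'\<in>A. if e' = e then (f e)\<^sup>2 * c e * r e e else 0)"
      using that(4) by (intro sum.cong) (auto simp: pairwise_def power2_eq_square)
    finally show ?thesis using that(3) by simp
  qed
  obtain E c where E: "independent E" "span E = S" "pairwise (\<lambda>e f. p e f = 0) E"
    and c: "\<And>e. e \<in> E \<Longrightarrow> B e = c e *\<^sub>R e"
    using orthogonal_eigenbasis[OF S p B] by metis
  obtain E' c' where E': "independent E'" "span E' = S" "pairwise (\<lambda>e f. p' e f = 0) E'"
    and c': "\<And>e. e \<in> E' \<Longrightarrow> B' e = c' e *\<^sub>R e"
    using orthogonal_eigenbasis[OF S p' B'] by metis
  define N where "N = {e\<in>E. c e < 0}"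
  define N' where "N' = {e\<in>E'. c' e < 0}"
  have fin: "finite E" "finite E'"
    using E(1) E'(1) by (auto intro: independent_imp_finite)
  have "x = 0" if x: "x \<in> span N" "x \<in> span (E' - N')" for x
  proof -
    have finN: "finite N" and finN': "finite (E' - N')"
      using fin by (auto simp: N_def)
    obtain f where f: "x = (\<Sum>e\<in>N. f e *\<^sub>R e)"
      using x(1) by (auto simp: span_finite[OF finN])
    obtain g where g: "x = (\<Sum>e\<in>E' - N'. g e *\<^sub>R e)"
      using x(2) by (auto simp: span_finite[OF finN'])
    have xS: "x \<in> S"
      using x(1) span_mono[of N E] E(2) by (auto simp: N_def)
    have pe: "p e e > 0" if "e \<in> E" for e
      using that p E(1,2) dependent_zero span_base unfolding inner_on_def by metis
    have pe': "p' e e > 0" if "e \<in> E'" for e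
      using that p' E'(1,2) dependent_zero span_base unfolding inner_on_def by metis
    have "p x (B x) = (\<Sum>e\<in>N. (f e)\<^sup>2 * c e * p e e)"
      unfolding f using p B E(3) c
      by (intro expand finN) (auto simp: N_def pairwise_def inner_on_def self_adjoint_on_def)
    moreover have "p' x (B' x) = (\<Sum>e\<in>E' - N'. (g e)\<^sup>2 * c' e * p' e e)"
      unfolding g using p' B' E'(3) c'
      by (intro expand finN') (auto simp: pairwise_def inner_on_def self_adjoint_on_def)
    moreover have "\<dots> \<ge> 0"
      using pe' by (intro sum_nonneg mult_nonneg_nonneg) (auto simp: N'_def intro: less_imp_le)
    ultimately have "(\<Sum>e\<in>N. - ((f e)\<^sup>2 * c e * p e e)) \<le> 0"
      using q[OF xS] by (simp add: sum_negf)
    moreover have nn: "- ((f e)\<^sup>2 * c e * p e e) \<ge> 0" if "e \<in> N" for e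
      using that pe[of e] by (simp add: N_def mult_nonneg_nonpos mult_nonpos_nonneg)
    \<comment> \<open>The two expansions of the common form give it opposite signs, so it is zero at
      \<open>x\<close>. Every summand over \<open>N\<close> then vanishes, and
      \<open>c e * p e e < 0\<close> yields \<open>f e = 0\<close>.\<close>
    ultimately have "(\<Sum>e\<in>N. - ((f e)\<^sup>2 * c e * p e e)) = 0"
      by (intro antisym sum_nonneg)
    then have "\<forall>e\<in>N. - ((f e)\<^sup>2 * c e * p e e) = 0"
      using nn by (subst (asm) sum_nonneg_eq_0_iff[OF finN])
    then have "\<forall>e\<in>N. f e = 0"
      using pe by (fastforce simp: N_def)
    then show "x = 0" by (simp add: f)
  qed
  then have "span N \<inter> span (E' - N') = {0}"
    using span_zero by blast
  \<comment> \<open>Trivial intersection bounds the sum of the two dimensions by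
    \<open>dim S\<close>, which is \<open>card E'\<close>; this leaves at most
    \<open>card N'\<close> for \<open>N\<close>.\<close>
  then have "dim (span N) + dim (span (E' - N')) = dim {x + y | x y. x \<in> span N \<and> y \<in> span (E' - N')}"
    using dim_sums_Int[of "span N" "span (E' - N')"] by simp
  also have "\<dots> \<le> dim S"
    using span_mono[of N E] span_mono[of "E' - N'" E'] E(2) E'(2) S
    by (intro dim_subset) (auto simp: N_def intro!: subspace_add)
  also have "\<dots> = card E'"
    using E'(1,2) by (metis dim_span_eq_card_independent)
  finally have "card N + card (E' - N') \<le> card E'"
    using independent_mono[OF E(1), of N] independent_mono[OF E'(1), of "E' - N'"]
    by (simp add: N_def dim_eq_card_independent)
  moreover have "card (E' - N') = card E' - card N'" "card N' \<le> card E'"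
    using fin by (auto simp: N'_def intro!: card_Diff_subset card_mono)
  ultimately have "card N \<le> card N'" by linarith
  moreover have "linear B" "linear B'"
    using B B' by (auto simp: self_adjoint_on_def)
  ultimately show ?thesis
    using num_neg_eigenvalues_on_eigenbasis[OF E(1) _ c]
      num_neg_eigenvalues_on_eigenbasis[OF E'(1) _ c'] E(2) E'(2)
    by (simp add: N_def N'_def)
qed

section \<open>The weighted inner product and the Hessian\<close>

lemma winner_commute: "winner w u v = winner w v u"
  by (simp add: winner_def mult_ac)

lemma bilinear_winner: "bilinear (winner w)"
  proof -
  have "(\<lambda>u. winner w u v) = winner w v" for v
    by (simp add: winner_commute fun_eq_iff)
  then show ?thesis
    by (simp add: bilinear_def linear_winner)
qed

lemma winner_pos:
  assumes "\<And>i. w $ i > 0" "x \<noteq> 0"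
  shows "winner w x x > 0"
proof -
  obtain i where "x $ i \<noteq> 0" using assms(2) by (auto simp: vec_eq_iff)
  then show ?thesis
    unfolding winner_def using assms(1) less_imp_le[OF assms(1)]
    by (intro sum_pos2[of UNIV i]) (auto simp: mult.assoc zero_less_mult_iff zero_le_mult_iff linorder_neq_iff)
qed

lemma subspace_mean_zero: "subspace (mean_zero w)"
  unfolding mean_zero_def by (rule linear_subspace_kernel[OF linear_winner])

lemma winner_hess_w:
  fixes w :: "real^'n"
  assumes "\<And>i. w $ i > 0"
  shows "winner w (hess_w w F u x) z = frechet (frechet F) u x z"
  unfolding hess_w_def
  by (rule riesz_works) (auto simp: assms bounded_linear.linear[OF blinfun.bounded_linear_right])

text \<open>Nondegeneracy, by testing with \<open>x - y\<close>. It lets identities for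
  \<open>hess_w\<close> be read off from its pairings.\<close>

lemma winner_cancel:
  fixes w :: "real^'n"
  assumes "\<And>i. w $ i > 0" "\<And>z. winner w x z = winner w y z"
  shows "x = y"
proof (rule ccontr)
  assume "x \<noteq> y"
  then have "winner w (x - y) (x - y) > 0"
    using winner_pos[OF assms(1), of "x - y"] by simp
  then show False
    by (simp add: bilinear_lsub[OF bilinear_winner] assms(2))
qed

lemma linear_hess_w:
  fixes w :: "real^'n"
  assumes w: "\<And>i. w $ i > 0"
  shows "linear (hess_w w F u)"
  by (intro linearI winner_cancel[OF w])
     (simp_all add: winner_hess_w[OF w] bilinear_ladd[OF bilinear_winner]
       bilinear_lmul[OF bilinear_winner] blinfun.bilinear_simps)

lemma self_adjoint_hess_w:
  fixes w :: "real^'n"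
  assumes w: "\<And>i. w $ i > 0" and F: "twice_frechet_differentiable F"
  shows "self_adjoint_w w (hess_w w F u)"
proof -
  have F': "(F has_derivative frechet F x) (at x)" for x
    using F by (intro frechet_works) (simp add: twice_frechet_differentiable_def)
  have "(frechet F has_derivative frechet (frechet F) u) (at u)"
    using F by (intro frechet_works) (simp add: twice_frechet_differentiable_def)
  from second_derivative_symmetric[OF F' this]
  have "winner w (hess_w w F u x) y = winner w x (hess_w w F u y)" for x y
    unfolding winner_commute[of w x] by (simp only: winner_hess_w[OF w])
  then show ?thesis by (simp add: self_adjoint_w_def)
qed

section \<open>Operators with kernel spanned by the constant vector\<close>

text \<open>The range of a self-adjoint operator is orthogonal to its kernel, which contains
  \<open>1\<close>.\<close>

lemma range_subset_mean_zero:
  fixes w :: "real^'n"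
  assumes A: "self_adjoint_w w A" "{u. A u = 0} = span {1}"
  shows "A x \<in> mean_zero w"
proof -
  have "A 1 = 0"
    using A(2) span_base[of 1 "{1::real^'n}"] by auto
  then have "winner w 1 (A x) = winner w 0 x"
    using A(1) by (metis self_adjoint_w_def)
  then show ?thesis by (simp add: mean_zero_def bilinear_lzero[OF bilinear_winner])
qed

text \<open>A kernel vector is a multiple of \<open>1\<close>, and \<open>winner w 1 1 > 0\<close>
  leaves only the zero multiple in \<open>mean_zero w\<close>.\<close>

lemma inj_on_mean_zero:
  fixes w :: "real^'n"
  assumes w: "\<And>i. w $ i > 0" and A: "linear A" "{u. A u = 0} = span {1}"
  shows "inj_on A (mean_zero w)"
proof -
  have "x = 0" if "x \<in> mean_zero w" "A x = 0" for x
  proof -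
    from that A(2) obtain c where c: "x = c *\<^sub>R 1"
      by (auto simp: span_singleton)
    moreover have "winner w 1 1 > 0" by (rule winner_pos[OF w]) simp
    ultimately show ?thesis
      using that(1) by (auto simp: mean_zero_def bilinear_rmul[OF bilinear_winner])
  qed
  then show ?thesis
    using linear_inj_on_iff_eq_0[OF A(1) subspace_mean_zero] by blast
qed

lemma bij_betw_subspace:
  fixes f :: "'a::euclidean_space \<Rightarrow> 'a"
  assumes "subspace S" "linear f" "f ` S \<subseteq> S" "inj_on f S"
  shows "bij_betw f S S"
proof -
  have "f ` S = S"
  proof (rule subspace_dim_equal)
    show "subspace (f ` S)" by (rule linear_subspace_image[OF assms(2,1)])
    show "dim S \<le> dim (f ` S)"
      using dim_image_eq[OF assms(2), of S] assms(1,4) span_eq_iff by (metis order_refl)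
  qed (use assms in auto)
  then show ?thesis using assms(4) by (simp add: bij_betw_def)
qed

text \<open>The form constructed here is \<^const>\<open>inner_op\<close> \<open>w A\<close>, with the inverse of \<open>A\<close> on
  \<^term>\<open>mean_zero w\<close> extended linearly to the whole space.\<close>

lemma hess_op_self_adjoint_on:
  fixes w :: "real^'n"
  assumes w: "\<And>i. w $ i > 0" and F: "twice_frechet_differentiable F"
    and A: "linear A" "self_adjoint_w w A" "pos_semidef_w w A" "{v. A v = 0} = span {1}"
  obtains p where "inner_on (mean_zero w) p" "self_adjoint_on (mean_zero w) p (hess_op w A F u)"
    "\<And>x. x \<in> mean_zero w \<Longrightarrow> p x (hess_op w A F u x) = winner w x (hess_w w F u x)"
proof -
  let ?S = "mean_zero w" and ?H = "hess_w w F u"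
  have S: "span ?S = ?S" using subspace_mean_zero by (simp add: span_eq_iff)
  have AS: "A x \<in> ?S" for x by (rule range_subset_mean_zero[OF A(2,4)])
  have inj: "inj_on A ?S" by (rule inj_on_mean_zero[OF w A(1,4)])
  have surj: "A ` ?S = ?S"
    using bij_betw_subspace[OF subspace_mean_zero A(1) _ inj] AS by (auto simp: bij_betw_def)
  obtain G where G: "linear G" "range G \<subseteq> ?S" "\<And>x. x \<in> ?S \<Longrightarrow> G (A x) = x"
    using linear_inj_on_left_inverse[OF A(1), of ?S] inj unfolding S by blast
  have AG: "A (G x) = x" if "x \<in> ?S" for x
    using that G(3) surj by (force simp: image_iff)
  have sa: "winner w (A x) y = winner w x (A y)" for x y
    using A(2) by (simp add: self_adjoint_w_def)
  define p where "p x y = winner w x (G y)" for x y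
  have bil: "bilinear p"
    using bilinear_winner[of w] linear_compose[OF G(1)]
    unfolding bilinear_def p_def by (auto simp: o_def)
  \<comment> \<open>\<open>A\<close> cancels its inverse inside \<open>p\<close>, which is why the
    quadratic form of \<open>hess_op\<close> turns out independent of \<open>A\<close>.\<close>
  have pA: "p x (A y) = winner w x y" if "x \<in> ?S" for x y
    using sa[of "G x" "G (A y)"] sa[of "G x" y] by (simp add: p_def AG AS that)
  have sym: "p x y = p y x" if "x \<in> ?S" "y \<in> ?S" for x y
    using sa[of "G x" "G y"] winner_commute[of w "G x" y] by (simp add: p_def AG that)
  have pos: "p x x > 0" if x: "x \<in> ?S" "x \<noteq> 0" for x
  proof -
    have nn: "p y y \<ge> 0" if "y \<in> ?S" for y
      using A(3)[unfolded pos_semidef_w_def, rule_format, of "G y"] by (simp add: p_def AG that)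
    \<comment> \<open>Semidefiniteness is sharpened to definiteness: if \<open>p x x = 0\<close>,
      moving from \<open>x\<close> along \<open>A x\<close> changes the form by
      \<open>2 * t * winner w x x\<close> to first order, so a suitable negative \<open>t\<close>
      makes it negative.\<close>
    have "p x x \<noteq> 0"
    proof
      assume 0: "p x x = 0"
      define a where "a = winner w x x"
      have a: "a > 0" using winner_pos[OF w x(2)] by (simp add: a_def)
      define b where "b = p (A x) (A x)"
      have b: "b \<ge> 0" using nn AS by (simp add: b_def)
      define t where "t = - a / (b + 1)"
      have t: "t < 0" using a b by (simp add: t_def divide_neg_pos)
      have "p (x + t *\<^sub>R A x) (x + t *\<^sub>R A x) = t * (2 * a + t * b)"
        using 0 pA[OF x(1), of x] sym[OF x(1) AS, of x]
        by (simp add: bilinear_ladd[OF bil] bilinear_radd[OF bil] bilinear_lmul[OF bil]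
            bilinear_rmul[OF bil] a_def b_def algebra_simps)
      also have "t * b = - a - t" using b by (simp add: t_def field_simps)
      finally have "p (x + t *\<^sub>R A x) (x + t *\<^sub>R A x) = t * (a - t)" by simp
      moreover have "x + t *\<^sub>R A x \<in> ?S"
        by (intro subspace_add subspace_scale subspace_mean_zero x(1) AS)
      ultimately have "0 \<le> t * (a - t)" using nn by force
      then show False using t a by (simp add: zero_le_mult_iff)
    qed
    then show ?thesis using nn[OF x(1)] by simp
  qed
  have H: "linear ?H" "winner w (?H x) y = winner w x (?H y)" for x y
    using linear_hess_w[OF w] self_adjoint_hess_w[OF w F] by (auto simp: self_adjoint_w_def)
  show thesis
  proof
    show "inner_on ?S p" using bil sym pos by (simp add: inner_on_def)
    have "linear (hess_op w A F u)"
      using linear_compose[OF H(1) A(1)] by (simp add: o_def hess_op_def[abs_def])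
    moreover have "p (A (?H x)) y = p x (A (?H y))" if "x \<in> ?S" "y \<in> ?S" for x y
    proof -
      have "p (A (?H x)) y = p y (A (?H x))" by (rule sym[OF AS that(2)])
      also have "\<dots> = winner w (?H x) y" using pA[OF that(2)] by (simp add: winner_commute)
      finally show ?thesis by (simp add: pA[OF that(1)] H(2))
    qed
    ultimately show "self_adjoint_on ?S p (hess_op w A F u)"
      using AS by (auto simp: self_adjoint_on_def hess_op_def)
    show "p x (hess_op w A F u x) = winner w x (?H x)" if "x \<in> ?S" for x
      using pA[OF that] by (simp add: hess_op_def)
  qed
qed

section \<open>Transfer of the saddle index from \<open>L\<close> to \<open>T\<close>\<close>

theorem theorem5:
  fixes w :: "real^'n"
    and F :: "real^'n \<Rightarrow> real"
    and L T :: "real^'n \<Rightarrow> real^'n"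
    and k :: nat
    and u :: "real^'n"
  assumes w_pos: "\<And>i. w $ i > 0"
    and w_sum: "(\<Sum>i\<in>UNIV. w $ i) = 1"
    and F: "twice_frechet_differentiable F"
    and L: "linear L" "self_adjoint_w w L" "pos_semidef_w w L" "{v. L v = 0} = span {1}"
    and T: "linear T" "self_adjoint_w w T" "pos_semidef_w w T" "{v. T v = 0} = span {1}"
    and saddle: "index_saddle w L F k u"
  shows "index_saddle w T F k u"
proof -
  let ?S = "mean_zero w"
  have ker: "L x = 0 \<longleftrightarrow> T x = 0" for x
    using L(4) T(4) by blast
  have lin: "linear (hess_op w A F u)" if "linear A" for A
    using linear_compose[OF linear_hess_w[OF w_pos] that] by (simp add: o_def hess_op_def[abs_def])
  have "inj_on (hess_op w L F u) ?S"
    using saddle by (auto simp: index_saddle_def bij_betw_def)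
  \<comment> \<open>Since \<open>L\<close> and \<open>T\<close> have the same kernel, so do their
    compositions with the Hessian.\<close>
  then have "inj_on (hess_op w T F u) ?S"
    using linear_inj_on_iff_eq_0[OF lin subspace_mean_zero] L(1) T(1) ker
    by (simp add: hess_op_def)
  then have bij: "bij_betw (hess_op w T F u) ?S ?S"
    using range_subset_mean_zero[OF T(2,4)]
    by (intro bij_betw_subspace[OF subspace_mean_zero lin[OF T(1)]]) (auto simp: hess_op_def)
  obtain p where p: "inner_on ?S p" "self_adjoint_on ?S p (hess_op w L F u)"
    "\<And>x. x \<in> ?S \<Longrightarrow> p x (hess_op w L F u x) = winner w x (hess_w w F u x)"
    using hess_op_self_adjoint_on[OF w_pos F L, of u] by blast
  obtain p' where p': "inner_on ?S p'" "self_adjoint_on ?S p' (hess_op w T F u)"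
    "\<And>x. x \<in> ?S \<Longrightarrow> p' x (hess_op w T F u x) = winner w x (hess_w w F u x)"
    using hess_op_self_adjoint_on[OF w_pos F T, of u] by blast
  \<comment> \<open>Both operators have the quadratic form of \<open>hess_w\<close> on
    \<open>?S\<close>, so the inertia inequality applies in both directions.\<close>
  have "num_neg_eigenvalues_on ?S (hess_op w L F u) = num_neg_eigenvalues_on ?S (hess_op w T F u)"
    using p(3) p'(3)
    by (intro antisym num_neg_eigenvalues_on_le[OF subspace_mean_zero p(1,2) p'(1,2)]
        num_neg_eigenvalues_on_le[OF subspace_mean_zero p'(1,2) p(1,2)]) auto
  with bij saddle show ?thesis
    by (simp add: index_saddle_def grad_op_def ker)
qed

end
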